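(* Let $G$ be a graph. If $\Delta(G) \leq 3$, then $\operatorname{diam}(\mathcal{I}(G)) \leq 4$.
   Context: Graphs are finite and simple; $\Delta(G)$ is the maximum degree of $G$. In an orientation $\vec{G}$ of a graph $G$, the inversion of a set $X \subseteq V(G)$ consists in reversing all arcs with both endvertices in $X$. The inversion graph $\mathcal{I}(G)$ is the graph whose vertices are the labelled orientations of $G$, two orientations being adjacent if and only if the inversion of some $X\subseteq V(G)$ transforms one into the other; $\operatorname{diam}(\mathcal{I}(G))$ is its diameter. *)

theory Defs
  imports "Graph_Theory.Pair_Digraph" "Graph_Theory.Shortest_Path"
begin

text \<open>
  A finite simple graph is a \<open>pair_graph\<close>, i.e. a finite loopless digraph without parallel arcs
  whose set of arcs is symmetric; an edge joining \<open>u\<close> and \<open>v\<close> is represented by the two arcs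
  \<open>(u, v)\<close> and \<open>(v, u)\<close>. Hence the degree of a vertex is its out-degree.
\<close>

text \<open>On \<open>nat\<close>, \<open>Sup {} = 0\<close>, so the maximum degree of the graph without vertices is 0.\<close>

definition max_degree :: "'a pair_pre_digraph \<Rightarrow> nat" where
  "max_degree G = (SUP v\<in>pverts G. out_degree (with_proj G) v)"

definition orientations :: "'a pair_pre_digraph \<Rightarrow> 'a pair_pre_digraph set" where
  "orientations G = {D. pverts D = pverts G \<and> parcs D \<subseteq> parcs G \<and>
     (\<forall>(u, v) \<in> parcs G. (u, v) \<in> parcs D \<longleftrightarrow> (v, u) \<notin> parcs D)}"

text \<open>\<open>swap_in S\<close> reverses the arcs in \<open>S\<close> and fixes all others.\<close>

definition inversion :: "'a set \<Rightarrow> 'a pair_pre_digraph \<Rightarrow> 'a pair_pre_digraph" where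
  "inversion X D = \<lparr> pverts = pverts D, parcs = swap_in (X \<times> X) ` parcs D \<rparr>"

text \<open>
  As the inversion graph is simple, an orientation is not adjacent to itself, although some
  inversions (e.g. that of the empty set) leave it unchanged.
\<close>

definition inversion_graph :: "'a pair_pre_digraph \<Rightarrow> 'a pair_pre_digraph pair_pre_digraph" where
  "inversion_graph G = \<lparr>
     pverts = orientations G,
     parcs = {(D, D'). D \<in> orientations G \<and> D' \<in> orientations G \<and> D \<noteq> D' \<and>
                (\<exists>X \<subseteq> pverts G. D' = inversion X D)} \<rparr>"

text \<open>
  With unit weights, \<open>\<mu>\<close> is the least length of a walk from \<open>u\<close> to \<open>v\<close>, and \<open>\<infinity>\<close> if there is none.
\<close>

definition distance :: "('a, 'b) pre_digraph \<Rightarrow> 'a \<Rightarrow> 'a \<Rightarrow> ereal" where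
  "distance H u v = wf_digraph.\<mu> H (\<lambda>_. 1) u v"

definition diameter :: "('a, 'b) pre_digraph \<Rightarrow> ereal" where
  "diameter H = (SUP u\<in>verts H. SUP v\<in>verts H. distance H u v)"


lemma mem_parcs_inversion:
  "(u, v) \<in> parcs (inversion X D) \<longleftrightarrow>
     (if u \<in> X \<and> v \<in> X then (v, u) \<in> parcs D else (u, v) \<in> parcs D)"
proof
  assume "(u, v) \<in> parcs (inversion X D)"
  then obtain a b where "(a, b) \<in> parcs D" "(u, v) = swap_in (X \<times> X) (a, b)"
    by (auto simp: inversion_def)
  then show "if u \<in> X \<and> v \<in> X then (v, u) \<in> parcs D else (u, v) \<in> parcs D"
    by (cases "a \<in> X \<and> b \<in> X") (auto simp: swap_in_def)
next
  assume *: "if u \<in> X \<and> v \<in> X then (v, u) \<in> parcs D else (u, v) \<in> parcs D"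
  show "(u, v) \<in> parcs (inversion X D)"
  proof (cases "u \<in> X \<and> v \<in> X")
    case True
    with * have "(v, u) \<in> parcs D" "swap_in (X \<times> X) (v, u) = (u, v)"
      by (simp_all add: swap_in_def)
    then show ?thesis by (simp add: inversion_def image_iff) (metis)
  next
    case False
    with * have "(u, v) \<in> parcs D" "swap_in (X \<times> X) (u, v) = (u, v)"
      by (auto simp: swap_in_def)
    then show ?thesis by (simp add: inversion_def image_iff) (metis)
  qed
qed

lemma orientationsD:
  assumes "D \<in> orientations G"
  shows "pverts D = pverts G"
    and "(u, v) \<in> parcs D \<Longrightarrow> (u, v) \<in> parcs G"
    and "(u, v) \<in> parcs G \<Longrightarrow> (u, v) \<in> parcs D \<longleftrightarrow> (v, u) \<notin> parcs D"
  using assms unfolding orientations_def by blast+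

lemma orientationsI:
  assumes "pverts D = pverts G"
    and "\<And>u v. (u, v) \<in> parcs D \<Longrightarrow> (u, v) \<in> parcs G"
    and "\<And>u v. (u, v) \<in> parcs G \<Longrightarrow> (u, v) \<in> parcs D \<longleftrightarrow> (v, u) \<notin> parcs D"
  shows "D \<in> orientations G"
  using assms unfolding orientations_def mem_Collect_eq by (intro conjI subrelI ballI) (blast, blast, simp only: split_paired_all split_conv)

lemma inversion_in_orientations:
  assumes "pair_graph G" "D \<in> orientations G"
  shows "inversion X D \<in> orientations G"
proof -
  interpret pair_graph G by fact
  show ?thesis
  proof (rule orientationsI)
    show "pverts (inversion X D) = pverts G"
      using orientationsD(1)[OF assms(2)] by (simp add: inversion_def)
  next
    fix u v assume "(u, v) \<in> parcs (inversion X D)"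
    then show "(u, v) \<in> parcs G"
      using orientationsD(2)[OF assms(2)] arcs_symmetric
      by (metis mem_parcs_inversion)
  next
    fix u v assume "(u, v) \<in> parcs G"
    then show "(u, v) \<in> parcs (inversion X D) \<longleftrightarrow> (v, u) \<notin> parcs (inversion X D)"
      using orientationsD(3)[OF assms(2)] by (metis mem_parcs_inversion)
  qed
qed

lemma inversion_inversion:
  "inversion X (inversion X D) = D"
proof -
  have "swap_in (X \<times> X) (swap_in (X \<times> X) a) = a" for a
    by (cases a; cases "fst a \<in> X \<and> snd a \<in> X") (auto simp: swap_in_def)
  then show ?thesis
    by (simp add: inversion_def image_image)
qed

lemma orientations_nonempty:
  assumes "pair_graph G"
  shows "orientations G \<noteq> {}"
proof -
  interpret pair_graph G by fact
  obtain f :: "'a \<Rightarrow> nat" where f: "inj_on f (pverts G)"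
    using finite_imp_inj_to_nat_seg[OF pair_finite_verts] by metis
  have "\<lparr> pverts = pverts G, parcs = {(u, v) \<in> parcs G. f u < f v} \<rparr> \<in> orientations G"
  proof (rule orientationsI)
    fix u v assume uv: "(u, v) \<in> parcs G"
    then have "f u \<noteq> f v"
      using f in_arcsD1 in_arcsD2 no_loops' by (metis inj_onD)
    moreover have "(v, u) \<in> parcs G" using uv arcs_symmetric by metis
    ultimately show "(u, v) \<in> parcs \<lparr> pverts = pverts G, parcs = {(u, v) \<in> parcs G. f u < f v} \<rparr> \<longleftrightarrow>
        (v, u) \<notin> parcs \<lparr> pverts = pverts G, parcs = {(u, v) \<in> parcs G. f u < f v} \<rparr>"
      using uv by auto
  qed simp_all
  then show ?thesis by blast
qed

lemma pair_graph_inversion_graph: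
  assumes "pair_graph G"
  shows "pair_graph (inversion_graph G)"
proof -
  interpret pair_graph G by fact
  have "orientations G \<subseteq> (\<lambda>A. \<lparr> pverts = pverts G, parcs = A \<rparr>) ` Pow (parcs G)"
  proof
    fix D assume "D \<in> orientations G"
    then have "D = \<lparr> pverts = pverts G, parcs = parcs D \<rparr>" "parcs D \<in> Pow (parcs G)"
      by (auto simp: orientations_def)
    then show "D \<in> (\<lambda>A. \<lparr> pverts = pverts G, parcs = A \<rparr>) ` Pow (parcs G)" by blast
  qed
  then have f: "finite (orientations G)"
    using pair_finite_arcs by (meson finite_Pow_iff finite_imageI finite_subset)
  have "parcs (inversion_graph G) \<subseteq> orientations G \<times> orientations G"
    by (auto simp: inversion_graph_def)
  then have f': "finite (parcs (inversion_graph G))"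
    using f by (meson finite_SigmaI finite_subset)
  have s: "(D', D) \<in> parcs (inversion_graph G)" if DD: "(D, D') \<in> parcs (inversion_graph G)" for D D'
  proof -
    from DD obtain X where "X \<subseteq> pverts G" "D' = inversion X D"
      "D \<in> orientations G" "D' \<in> orientations G" "D \<noteq> D'"
      unfolding inversion_graph_def by auto
    moreover from this have "D = inversion X D'" by (simp add: inversion_inversion)
    ultimately show ?thesis unfolding inversion_graph_def by auto
  qed
  show ?thesis
  proof
    show "finite (pverts (inversion_graph G))" using f by (simp add: inversion_graph_def)
    show "finite (parcs (inversion_graph G))" by (fact f')
    show "symmetric (with_proj (inversion_graph G))"
      unfolding symmetric_def sym_def using s by simp
  qed (auto simp: inversion_graph_def)
qed

end

(*
  Inverting X_1, ..., X_4 reverses the edge uv iff the number of i with u, v in X_i is odd. Encoding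
  the family (X_i) by a vector f(v) in F_2^4 for each vertex v, the task is to solve
  f(u) . f(v) = p(uv) for a prescribed labelling p of the edges.

  Choose the vectors greedily, so that an uncoloured vertex always either has linearly independent
  vectors on its coloured neighbours, or has all its neighbours coloured and a solvable system. A
  count in F_2^4 shows that a vertex v can be coloured unless v and one neighbour w are the only
  uncoloured vertices in the closed neighbourhoods of both, both have degree 3, and vw has label 1
  while the four adjacent edges have label 0. The edges of the latter kind form a matching. Colour
  its vertices first: build the order backwards, prepending for a matched vertex a with partner b
  and another neighbour w either b, a (if w comes later) or b, v, a, w, where v is the partner of w.
  Then the first vertex of each matching edge is coloured while a further neighbour is uncoloured.
*)

theory Submission
  imports Defs "HOL-Analysis.Finite_Cartesian_Product" "HOL-Library.Z2"
begin

section \<open>Linear systems over the field with two elements\<close>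

lemma bit_vec_add_self [simp]: "x + x = 0" for x :: "bit ^ 'n"
  by (simp add: vec_eq_iff)

lemma scalar_product_commute: "scalar_product x y = scalar_product y x"
  for x :: "'b::comm_semiring_1 ^ 'n"
  by (simp add: scalar_product_def mult.commute)

lemma scalar_product_add_left: "scalar_product (x + y) z = scalar_product x z + scalar_product y z"
  by (simp add: scalar_product_def distrib_right sum.distrib)

lemma scalar_product_add_right: "scalar_product x (y + z) = scalar_product x y + scalar_product x z"
  by (simp add: scalar_product_def distrib_left sum.distrib)

lemma scalar_product_zero [simp]: "scalar_product x 0 = 0" "scalar_product 0 x = 0"
  by (simp_all add: scalar_product_def)

lemma scalar_product_axis: "scalar_product (axis i 1) x = x $ i"
  by (simp add: scalar_product_def axis_def if_distrib[of "\<lambda>c. c * _"] cong: if_cong)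

text \<open>As 0 and 1 are the only scalars, this is the linear span of the family.\<close>

definition subset_sums :: "('a \<Rightarrow> bit ^ 'n) \<Rightarrow> 'a set \<Rightarrow> (bit ^ 'n) set" where
  "subset_sums f A = sum f ` Pow A"

text \<open>For finite \<open>A\<close>, linear independence of an indexed family: a repeated vector
  makes it dependent.\<close>

definition independent_on :: "('a \<Rightarrow> bit ^ 'n) \<Rightarrow> 'a set \<Rightarrow> bool" where
  "independent_on f A \<longleftrightarrow> (\<forall>T\<subseteq>A. T \<noteq> {} \<longrightarrow> sum f T \<noteq> 0)"

definition solutions :: "('a \<Rightarrow> bit ^ 'n) \<Rightarrow> ('a \<Rightarrow> bit) \<Rightarrow> 'a set \<Rightarrow> (bit ^ 'n) set" where
  "solutions f b A = {x. \<forall>u\<in>A. scalar_product x (f u) = b u}"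

lemma independent_on_cong:
  "(\<And>u. u \<in> A \<Longrightarrow> f u = g u) \<Longrightarrow> independent_on f A \<longleftrightarrow> independent_on g A"
  unfolding independent_on_def by (metis (no_types, lifting) subsetD sum.cong)

lemma solutions_cong:
  "(\<And>u. u \<in> A \<Longrightarrow> f u = g u) \<Longrightarrow> solutions f b A = solutions g b A"
  by (simp add: solutions_def)

lemma zero_in_subset_sums: "0 \<in> subset_sums f A"
  unfolding subset_sums_def by (rule image_eqI[of _ _ "{}"]) auto

lemma in_subset_sums: "u \<in> A \<Longrightarrow> f u \<in> subset_sums f A"
  unfolding subset_sums_def by (rule image_eqI[of _ _ "{u}"]) auto

lemma subset_sums_mono: "A \<subseteq> B \<Longrightarrow> subset_sums f A \<subseteq> subset_sums f B"
  unfolding subset_sums_def by blast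

lemma card_subset_sums_le: "finite A \<Longrightarrow> card (subset_sums f A) \<le> 2 ^ card A"
  unfolding subset_sums_def by (metis card_Pow card_image_le finite_Pow_iff)

lemma add_in_subset_sums_insert:
  assumes "finite A" "a \<notin> A" "z + f a \<in> subset_sums f A"
  shows "z \<in> subset_sums f (insert a A)"
proof -
  obtain T where T: "T \<subseteq> A" "z + f a = sum f T"
    using assms(3) by (auto simp: subset_sums_def)
  have "finite T" "a \<notin> T"
    using T assms finite_subset by auto
  then have "sum f (insert a T) = (z + f a) + f a"
    using T by (simp add: add.commute)
  also have "\<dots> = z"
    by (simp add: add.assoc)
  finally show ?thesis
    unfolding subset_sums_def using T by (intro image_eqI[of _ _ "insert a T"]) auto
qed

lemma independent_on_insert:
  assumes "finite A" "a \<notin> A"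
  shows "independent_on f (insert a A) \<longleftrightarrow> independent_on f A \<and> f a \<notin> subset_sums f A"
proof
  assume *: "independent_on f (insert a A)"
  have "f a \<noteq> sum f T" if "T \<subseteq> A" for T
  proof
    assume fa: "f a = sum f T"
    have "finite T" "a \<notin> T"
      using that assms finite_subset by auto
    with fa have "sum f (insert a T) = 0"
      by simp
    moreover have "insert a T \<subseteq> insert a A"
      using that by blast
    ultimately show False
      using * unfolding independent_on_def by blast
  qed
  then have "f a \<notin> subset_sums f A"
    by (auto simp: subset_sums_def)
  with * show "independent_on f A \<and> f a \<notin> subset_sums f A"
    unfolding independent_on_def by blast
next
  assume *: "independent_on f A \<and> f a \<notin> subset_sums f A"
  show "independent_on f (insert a A)"
    unfolding independent_on_def
  proof (intro allI impI notI)
    fix T assume T: "T \<subseteq> insert a A" "T \<noteq> {}" "sum f T = 0"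
    show False
    proof (cases "a \<in> T")
      case True
      have "finite T" using T assms finite_subset by blast
      then have "sum f T = f a + sum f (T - {a})"
        using True by (rule sum.remove)
      with T have "f a = - sum f (T - {a})"
        by (simp add: eq_neg_iff_add_eq_0)
      then have "f a = sum f (T - {a})"
        by (simp add: minus_unique)
      moreover have "T - {a} \<subseteq> A"
        using T by blast
      ultimately show False
        using * by (auto simp: subset_sums_def)
    next
      case False
      then have "T \<subseteq> A"
        using T by blast
      with T * show False
        by (auto simp: independent_on_def)
    qed
  qed
qed

text \<open>The double orthogonal complement of a span is the span. If some \<open>y0\<close>
  orthogonal to the vectors on \<open>A\<close> is not orthogonal to \<open>z\<close>, it is not
  orthogonal to \<open>f a\<close> either, and the induction hypothesis applies to
  \<open>z + f a\<close>.\<close>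

lemma subset_sums_if_orthogonal:
  fixes f :: "'a \<Rightarrow> bit ^ 'n"
  assumes "finite A"
    and "\<And>y. y \<in> solutions f (\<lambda>_. 0) A \<Longrightarrow> scalar_product y z = 0"
  shows "z \<in> subset_sums f A"
  using assms
proof (induction A arbitrary: z)
  case empty
  then have "z $ i = 0" for i
    using scalar_product_axis[of i z] by (simp add: solutions_def)
  then have "z = 0"
    by (simp add: vec_eq_iff)
  then show ?case
    by (simp add: zero_in_subset_sums)
next
  case (insert a A)
  show ?case
  proof (cases "\<forall>y\<in>solutions f (\<lambda>_. 0) A. scalar_product y z = 0")
    case True
    then have "z \<in> subset_sums f A"
      using insert.IH by blast
    then show ?thesis
      using subset_sums_mono[of A "insert a A" f] by blast
  next
    case False
    then obtain y0 where y0: "y0 \<in> solutions f (\<lambda>_. 0) A" "scalar_product y0 z = 1"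
      by auto
    then have y0a: "scalar_product y0 (f a) = 1"
      using insert.prems[of y0] by (cases "scalar_product y0 (f a)") (auto simp: solutions_def)
    have "scalar_product y (z + f a) = 0" if y: "y \<in> solutions f (\<lambda>_. 0) A" for y
    proof (cases "scalar_product y (f a) = 0")
      case True
      then show ?thesis
        using insert.prems[of y] y by (simp add: solutions_def scalar_product_add_right)
    next
      case False
      \<comment> \<open>Both \<open>y\<close> and \<open>y0\<close> have product 1 with
        \<open>f a\<close>, so their sum is orthogonal to all vectors on
        \<open>insert a A\<close>.\<close>
      have "scalar_product (y + y0) z = 0"
        using y y0 y0a False
        by (intro insert.prems) (simp add: solutions_def scalar_product_add_left)
      then show ?thesis
        using y0 False
        by (cases "scalar_product y z") (simp_all add: scalar_product_add_left scalar_product_add_right)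
    qed
    then have "z + f a \<in> subset_sums f A"
      by (rule insert.IH)
    then show ?thesis
      using insert.hyps by (intro add_in_subset_sums_insert)
  qed
qed

lemma card_UNIV_bit_vec: "CARD(bit ^ 'n) = 2 ^ CARD('n::finite)"
proof -
  have "(UNIV :: bit set) = {0, 1}"
    by (metis (full_types) UNIV_eq_I bit.exhaust insertCI)
  then have "CARD(bit) = card {0, 1 :: bit}"
    by (rule arg_cong)
  then show ?thesis
    by (simp add: numeral_2_eq_2)
qed

lemma finite_bit_vec_set [simp]: "finite X" for X :: "(bit ^ 'n::finite) set"
proof -
  have "finite (UNIV :: (bit ^ 'n) set)"
    by (rule card_ge_0_finite) (simp only: card_UNIV_bit_vec zero_less_power zero_less_numeral)
  then show ?thesis
    by (rule finite_subset[OF subset_UNIV])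
qed

text \<open>Each further independent equation halves the solution set: translation by some
  \<open>y0\<close> orthogonal to the old vectors but not to \<open>f a\<close> swaps the two values
  of the new product.\<close>

lemma card_solutions:
  fixes f :: "'a \<Rightarrow> bit ^ 'n"
  assumes "finite A" "independent_on f A"
  shows "card (solutions f b A) * 2 ^ card A = 2 ^ CARD('n)"
  using assms
proof (induction A)
  case empty
  show ?case
    by (simp add: solutions_def card_UNIV_bit_vec del: CARD_vec)
next
  case (insert a A)
  then have ind: "independent_on f A" "f a \<notin> subset_sums f A"
    by (simp_all add: independent_on_insert)
  then obtain y0 where y0: "y0 \<in> solutions f (\<lambda>_. 0) A" "scalar_product y0 (f a) = 1"
    using subset_sums_if_orthogonal[OF insert.hyps(1)] by fastforce
  define P where "P = {x \<in> solutions f b A. scalar_product x (f a) = b a}"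
  define Q where "Q = {x \<in> solutions f b A. scalar_product x (f a) \<noteq> b a}"
  have "bij_betw (\<lambda>x. x + y0) P Q"
  proof (rule bij_betw_byWitness[where f' = "\<lambda>x. x + y0"])
    show "(\<lambda>x. x + y0) ` P \<subseteq> Q" "(\<lambda>x. x + y0) ` Q \<subseteq> P"
      using y0 by (cases "b a"; auto simp: P_def Q_def solutions_def scalar_product_add_left)+
  qed (auto simp: add.assoc)
  then have "card P = card Q"
    by (rule bij_betw_same_card)
  moreover have "card (solutions f b A) = card P + card Q"
    by (subst card_Un_disjoint[symmetric]) (auto simp: P_def Q_def intro: arg_cong[of _ _ card])
  moreover have "P = solutions f b (insert a A)"
    by (auto simp: P_def solutions_def)
  ultimately show ?case
    using insert.IH[OF ind(1)] insert.hyps by (simp add: algebra_simps)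
qed

lemma solutions_nonempty:
  fixes f :: "'a \<Rightarrow> bit ^ 'n"
  assumes "finite A" "independent_on f A"
  shows "solutions f b A \<noteq> {}"
  using card_solutions[OF assms, of b] by (intro notI) simp


section \<open>Realizing edge labellings of subcubic graphs\<close>

locale subcubic_edge_labelling =
  fixes V :: "'a set" and N :: "'a \<Rightarrow> 'a set" and p :: "'a \<Rightarrow> 'a \<Rightarrow> bit"
  assumes finite_V: "finite V"
    and N_subset: "N v \<subseteq> V"
    and N_sym: "u \<in> N v \<Longrightarrow> v \<in> N u"
    and N_irrefl: "v \<notin> N v"
    and card_N: "card (N v) \<le> 3"
    and p_sym: "p u v = p v u"
begin

section \<open>Greedy colouring by vectors of F_2^4\<close>

lemma finite_N [simp]: "finite (N v)"
  using N_subset finite_V by (rule finite_subset)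

text \<open>Independence keeps the system at \<open>w\<close> solvable whatever the labels. Once all
  neighbours are coloured, solvability alone suffices, so the last vector may lie in the span of the
  others.\<close>

definition extendable :: "'a set \<Rightarrow> ('a \<Rightarrow> bit ^ 4) \<Rightarrow> 'a \<Rightarrow> bool" where
  "extendable S f w \<longleftrightarrow>
     (if N w \<subseteq> S then solutions f (p w) (N w) \<noteq> {} else independent_on f (N w \<inter> S))"

definition good :: "'a set \<Rightarrow> ('a \<Rightarrow> bit ^ 4) \<Rightarrow> bool" where
  "good S f \<longleftrightarrow> (\<forall>u\<in>S. \<forall>v\<in>N u \<inter> S. scalar_product (f u) (f v) = p u v) \<and>
     (\<forall>w\<in>V - S. extendable S f w)"

text \<open>The edges at which the greedy step can fail.\<close>

definition isolated :: "'a \<Rightarrow> 'a \<Rightarrow> bool" where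
  "isolated v w \<longleftrightarrow> w \<in> N v \<and> p v w = 1 \<and> card (N v) = 3 \<and> card (N w) = 3 \<and>
     (\<forall>u\<in>N v - {w}. p v u = 0) \<and> (\<forall>u\<in>N w - {v}. p w u = 0)"

text \<open>\<open>S\<close> holds the vertices coloured before \<open>v\<close>. What is excluded
  is that \<open>v\<close> and its partner are each other's only uncoloured neighbour.\<close>

definition safe :: "'a set \<Rightarrow> 'a \<Rightarrow> bool" where
  "safe S v \<longleftrightarrow> (\<forall>w. isolated v w \<longrightarrow> w \<notin> S \<longrightarrow> N v \<subseteq> insert w S \<longrightarrow> \<not> N w \<subseteq> insert v S)"

text \<open>Only the uncoloured neighbours \<open>w\<close> of \<open>v\<close> are affected. Either
  \<open>x\<close> extends their independent family, or \<open>v\<close> is the last neighbour of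
  \<open>w\<close> and a solution \<open>y\<close> of the old equations also meets the new
  one.\<close>

lemma good_insert:
  assumes good: "good S f" and v: "v \<in> V - S"
    and x: "x \<in> solutions f (p v) (N v \<inter> S)"
    and ext: "\<And>w. w \<in> N v - S \<Longrightarrow> x \<notin> subset_sums f (N w \<inter> S) \<or>
       N w \<subseteq> insert v S \<and> (\<exists>y\<in>solutions f (p w) (N w \<inter> S). scalar_product y x = p w v)"
  shows "good (insert v S) (f(v := x))"
proof -
  let ?g = "f(v := x)"
  have "extendable (insert v S) ?g w" if w: "w \<in> V - insert v S" for w
  proof (cases "v \<in> N w")
    case False
    then have "N w \<inter> insert v S = N w \<inter> S" "N w \<subseteq> insert v S \<longleftrightarrow> N w \<subseteq> S"
      by auto
    moreover have "independent_on ?g (N w \<inter> S) \<longleftrightarrow> independent_on f (N w \<inter> S)"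
      using v by (intro independent_on_cong) auto
    moreover have "solutions ?g (p w) (N w) = solutions f (p w) (N w)"
      using False by (intro solutions_cong) auto
    moreover have "extendable S f w"
      using good w by (auto simp: good_def)
    ultimately show ?thesis
      by (simp add: extendable_def)
  next
    case True
    have wv: "w \<in> N v - S"
      using True N_sym w by auto
    have "extendable S f w"
      using good w by (auto simp: good_def)
    then have ind: "independent_on f (N w \<inter> S)"
      using True v by (auto simp: extendable_def split: if_splits)
    have Nw: "N w \<inter> insert v S = insert v (N w \<inter> S)"
      using True by auto
    have eq: "independent_on ?g (N w \<inter> S) \<longleftrightarrow> independent_on f (N w \<inter> S)"
      "subset_sums ?g (N w \<inter> S) = subset_sums f (N w \<inter> S)"
      using v unfolding subset_sums_def by (intro independent_on_cong image_cong sum.cong; auto)+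
    consider (new) "x \<notin> subset_sums f (N w \<inter> S)"
      | (old) y where "N w \<subseteq> insert v S" "y \<in> solutions f (p w) (N w \<inter> S)" "scalar_product y x = p w v"
      using ext[OF wv] by blast
    then show ?thesis
    proof cases
      case new
      then have i: "independent_on ?g (N w \<inter> insert v S)"
        unfolding Nw using ind v by (subst independent_on_insert) (auto simp: eq)
      moreover have "solutions ?g (p w) (N w) \<noteq> {}" if "N w \<subseteq> insert v S"
        using i that by (intro solutions_nonempty) (auto simp: Int_absorb2)
      ultimately show ?thesis
        by (simp add: extendable_def)
    next
      case old
      then have "y \<in> solutions ?g (p w) (N w)"
        by (auto simp: solutions_def)
      with old show ?thesis
        by (auto simp: extendable_def)
    qed
  qed
  moreover have "scalar_product (?g u) (?g w) = p u w" if "u \<in> insert v S" "w \<in> N u \<inter> insert v S" for u w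
    using that good v x N_irrefl[of v] N_sym[of w u] p_sym[of w v] p_sym[of u v]
    by (auto simp: good_def solutions_def scalar_product_commute[of "f u" x])
  ultimately show ?thesis
    unfolding good_def by blast
qed

text \<open>The new vector is sought in the solution set \<open>X\<close>, outside the spans
  \<open>W w\<close> for the uncoloured neighbours \<open>w\<close>. Counting leaves one tight case,
  \<open>X = W w\<close>, where a vector inside the span is chosen that keeps the system at
  \<open>w\<close> solvable.\<close>

lemma good_step:
  assumes good: "good S f" and v: "v \<in> V - S" and safe: "safe S v"
  shows "\<exists>g. good (insert v S) g"
proof (cases "N v \<subseteq> S")
  case True
  moreover have "extendable S f v"
    using good v by (auto simp: good_def)
  ultimately obtain x where "x \<in> solutions f (p v) (N v \<inter> S)"
    by (auto simp: extendable_def Int_absorb2)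
  then show ?thesis
    using good_insert[OF good v, of x] True by blast
next
  case False
  define A where "A = N v \<inter> S"
  define B where "B = N v - S"
  define X where "X = solutions f (p v) A"
  have AB: "finite A" "finite B" "N v = A \<union> B" "A \<inter> B = {}" "B \<noteq> {}"
    using False by (auto simp: A_def B_def)
  then have "card A + card B = card (N v)"
    by (simp add: card_Un_disjoint)
  then have cAB: "card A + card B \<le> 3" "card B \<ge> 1"
    using card_N[of v] AB by (auto simp: Suc_le_eq card_gt_0_iff)
  have indA: "independent_on f A"
    using good v False unfolding good_def extendable_def A_def by auto
  have cX: "card X * 2 ^ card A = 16"
    using card_solutions[OF AB(1) indA, of "p v"] by (simp add: X_def)
  have cN: "card (N w \<inter> S) \<le> 2" "independent_on f (N w \<inter> S)" if "w \<in> B" for w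
  proof -
    have vw: "v \<in> N w"
      using that N_sym by (auto simp: B_def)
    have "card (N w \<inter> S) < card (N w)"
      using v vw by (intro psubset_card_mono) auto
    then show "card (N w \<inter> S) \<le> 2"
      using card_N[of w] by simp
    have "extendable S f w"
      using good that N_subset[of v] unfolding good_def B_def by blast
    then show "independent_on f (N w \<inter> S)"
      using vw v by (auto simp: extendable_def split: if_splits)
  qed
  define W where "W w = subset_sums f (N w \<inter> S)" for w
  have cW: "card (W w) \<le> 2 ^ card (N w \<inter> S)" for w
    unfolding W_def by (intro card_subset_sums_le) auto
  have cW4: "card (W w) \<le> 4" if "w \<in> B" for w
  proof -
    have "(2::nat) ^ card (N w \<inter> S) \<le> 2 ^ 2"
      using cN[OF that] by (intro power_increasing) auto
    with cW[of w] show ?thesis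
      by simp
  qed
  \<comment> \<open>The sets \<open>W w\<close> share the vector 0, so they can cover \<open>X\<close> only if \<open>X = W w\<close> for a single \<open>w\<close>.\<close>
  have "\<exists>x\<in>X. \<forall>w\<in>B. x \<notin> W w \<or>
       N w \<subseteq> insert v S \<and> (\<exists>y\<in>solutions f (p w) (N w \<inter> S). scalar_product y x = p w v)"
  proof (cases "X \<subseteq> (\<Union>w\<in>B. W w)")
    case False
    then show ?thesis by blast
  next
    case XW: True
    have "X \<subseteq> insert 0 (\<Union>w\<in>B. W w - {0})"
      using XW by blast
    then have "card X \<le> card (insert 0 (\<Union>w\<in>B. W w - {0}))"
      by (intro card_mono) auto
    also have "\<dots> \<le> 1 + card (\<Union>w\<in>B. W w - {0})"
      by (subst card_insert_if) (simp_all del: UN_simps)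
    also have "card (\<Union>w\<in>B. W w - {0}) \<le> (\<Sum>w\<in>B. card (W w - {0}))"
      using AB by (intro card_UN_le)
    also have "\<dots> \<le> (\<Sum>w\<in>B. 3)"
    proof (rule sum_mono)
      fix w assume "w \<in> B"
      then show "card (W w - {0}) \<le> 3"
        using cW4[of w] zero_in_subset_sums[of f "N w \<inter> S"] by (simp add: W_def)
    qed
    finally have "card X \<le> 1 + 3 * card B"
      by simp
    moreover have "card A = 0 \<or> card A = 1 \<or> card A = 2"
      using cAB by linarith
    \<comment> \<open>For \<open>card A\<close> = 0, 1, 2 the set \<open>X\<close> has 16, 8, 4
      elements, while the bound is at most 10, 7, 4.\<close>
    ultimately have cA: "card A = 2" and cX4: "card X = 4" and "card B = 1"
      using cX cAB by auto
    then obtain w where w: "B = {w}"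
      using card_1_singletonE by blast
    have "X \<subseteq> W w"
      using XW w by simp
    moreover have "card (W w) \<le> card X"
      using cW4 w cX4 by simp
    ultimately have XW: "X = W w"
      by (intro card_seteq) auto
    \<comment> \<open>Fewer coloured neighbours would span at most two vectors; with
      \<open>v\<close>, this gives \<open>w\<close> degree 3.\<close>
    have "card (N w \<inter> S) = 2"
    proof (rule ccontr)
      assume "card (N w \<inter> S) \<noteq> 2"
      then have "card (N w \<inter> S) \<le> 1"
        using cN[of w] w by simp
      then have "(2::nat) ^ card (N w \<inter> S) \<le> 2 ^ 1"
        by (intro power_increasing) auto
      with cW[of w] XW cX4 show False
        by simp
    qed
    moreover have vw: "v \<in> N w" "w \<in> N v" "w \<notin> S" "v \<notin> S"
      using w N_sym v by (auto simp: B_def)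
    ultimately have c3: "card (insert v (N w \<inter> S)) = 3"
      by simp
    moreover have "insert v (N w \<inter> S) \<subseteq> N w"
      using vw by blast
    ultimately have Nw: "insert v (N w \<inter> S) = N w"
      using card_N[of w] by (intro card_seteq) simp_all
    with c3 have cNw: "card (N w) = 3"
      by simp
    have Nv: "N v = insert w A" "card (N v) = 3"
      using AB w cA by auto
    obtain y where y: "y \<in> solutions f (p w) (N w \<inter> S)"
      using solutions_nonempty[of "N w \<inter> S" f "p w"] cN w by auto
    \<comment> \<open>A span contains 0, so the system at \<open>v\<close> is homogeneous: every
      edge at \<open>v\<close> except the one to \<open>w\<close> has label 0.\<close>
    have "0 \<in> X"
      unfolding XW W_def by (rule zero_in_subset_sums)
    then have p0: "p v u = 0" if "u \<in> N v - {w}" for u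
      using that Nv by (auto simp: X_def solutions_def)
    have "\<exists>x\<in>X. scalar_product y x = p w v"
    proof (cases "p w v = 0")
      case True
      with \<open>0 \<in> X\<close> show ?thesis
        by (intro bexI[of _ 0]) auto
    next
      case False
      \<comment> \<open>The edge to \<open>w\<close> has label 1 here, so by safety another edge
        from \<open>w\<close>, to some \<open>u\<close>, has label 1 as well; then
        \<open>f u\<close> has the required product with \<open>y\<close>.\<close>
      have "\<not> isolated v w"
        using safe vw Nw Nv unfolding safe_def A_def by blast
      then obtain u where u: "u \<in> N w - {v}" "p w u = 1"
        using p0 vw cNw Nv(2) False p_sym[of v w] unfolding isolated_def by auto
      then have "u \<in> N w \<inter> S"
        using Nw by blast
      then have "f u \<in> X" "scalar_product y (f u) = p w v"
        using y u False unfolding XW W_def by (auto intro: in_subset_sums simp: solutions_def)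
      then show ?thesis by blast
    qed
    then show ?thesis
      using w y Nw by blast
  qed
  then show ?thesis
    using good_insert[OF good v] unfolding X_def A_def B_def W_def by blast
qed

text \<open>
  As \<open>good_step\<close> applies to any good colouring, the uncoloured vertices can be ordered without
  reference to a particular colouring.
\<close>

definition completable :: "'a set \<Rightarrow> bool" where
  "completable S \<longleftrightarrow> ((\<exists>f. good S f) \<longrightarrow> (\<exists>f. good V f))"

lemma completable_insert:
  "completable (insert v S) \<Longrightarrow> v \<in> V - S \<Longrightarrow> safe S v \<Longrightarrow> completable S"
  using good_step[of S _ v] by (auto simp: completable_def)

text \<open>The order is built from its end: removing \<open>v\<close> from \<open>S\<close> puts
  \<open>v\<close> just before the vertices ordered so far.\<close>

lemma completable_Diff:
  assumes "completable S" "S \<subseteq> V" "v \<in> S" "safe (S - {v}) v"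
  shows "completable (S - {v})"
  using assms by (intro completable_insert[of v "S - {v}"]) (auto simp: insert_absorb)

section \<open>The matching of critical edges and the order of its vertices\<close>

lemma isolated_sym: "isolated v w \<Longrightarrow> isolated w v"
  unfolding isolated_def by (simp add: N_sym[of w v] p_sym[of w v])

text \<open>The critical edges form a matching, since such an edge is the only one with label 1 at
  its ends.\<close>

lemma isolated_unique:
  assumes "isolated v w" "isolated v w'"
  shows "w' = w"
proof (rule ccontr)
  assume "w' \<noteq> w"
  then have "p v w' = 0"
    using assms unfolding isolated_def by blast
  then show False
    using assms(2) by (simp add: isolated_def)
qed

lemma isolated_neq: "isolated v w \<Longrightarrow> v \<noteq> w"
  unfolding isolated_def using N_irrefl[of v] by blast

text \<open>Two sources of safety: here the partner is already coloured; in the next lemma it has a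
  further uncoloured neighbour.\<close>

lemma safe_if_partner_in: "isolated v w \<Longrightarrow> w \<in> S \<Longrightarrow> safe S v"
  unfolding safe_def by (auto dest: isolated_unique)

lemma safe_if_partner_neighbour:
  "isolated v w \<Longrightarrow> u \<in> N w \<Longrightarrow> u \<noteq> v \<Longrightarrow> u \<notin> S \<Longrightarrow> safe S v"
  unfolding safe_def by (auto dest: isolated_unique)

definition matched :: "'a set" where
  "matched = {v. \<exists>w. isolated v w}"

lemma matched_subset: "matched \<subseteq> V"
proof
  fix v assume "v \<in> matched"
  then obtain w where "w \<in> N v"
    by (auto simp: matched_def isolated_def)
  then show "v \<in> V"
    using N_sym N_subset by blast
qed

text \<open>Vertices outside \<open>matched\<close> have no partner, hence are always safe and can
  come last in any order.\<close>

lemma completable_matched: "completable matched"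
proof -
  have "completable S" if "matched \<subseteq> S" "S \<subseteq> V" for S
    using that
  proof (induction "card (V - S)" arbitrary: S rule: less_induct)
    case less
    show ?case
    proof (cases "S = V")
      case True
      then show ?thesis by (simp add: completable_def)
    next
      case False
      then obtain v where v: "v \<in> V - S"
        using less.prems by blast
      then have "card (V - insert v S) < card (V - S)"
        using finite_V by (intro psubset_card_mono) auto
      then have "completable (insert v S)"
        using less v by blast
      moreover have "safe S v"
        using v less.prems by (auto simp: safe_def matched_def)
      ultimately show ?thesis
        using v completable_insert by blast
    qed
  qed
  then show ?thesis
    using matched_subset by blast
qed

definition partner_closed :: "'a set \<Rightarrow> bool" where
  "partner_closed S \<longleftrightarrow> S \<subseteq> matched \<and> (\<forall>a\<in>S. \<forall>b. isolated a b \<longrightarrow> b \<in> S)"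

text \<open>One stage of the backward construction removes one or two whole matching edges; the
  vertex removed last is coloured first.\<close>

lemma completable_shrink:
  assumes S: "partner_closed S" "completable S" "S \<noteq> {}"
  shows "\<exists>T. T \<subset> S \<and> partner_closed T \<and> completable T"
proof -
  obtain a b where ab: "a \<in> S" "isolated a b"
    using S unfolding partner_closed_def matched_def by blast
  have SV: "S \<subseteq> V"
    using S matched_subset by (auto simp: partner_closed_def)
  have bS: "b \<in> S" "isolated b a" "a \<noteq> b"
    using S ab isolated_sym isolated_neq by (auto simp: partner_closed_def)
  have "card (N a - {b}) \<noteq> 0"
    using ab by (simp add: isolated_def)
  then obtain w where w: "w \<in> N a" "w \<noteq> b"
    by (metis Diff_iff all_not_in_conv card.empty singletonI)
  have wa: "w \<noteq> a" "a \<in> N w"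
    using w N_irrefl N_sym by blast+
  show ?thesis
  proof (cases "w \<in> S")
    case False
    \<comment> \<open>Here \<open>w\<close> is coloured after all of \<open>S\<close>, so it makes
      \<open>b\<close> safe as an uncoloured neighbour of its partner \<open>a\<close>.\<close>
    have "completable (S - {a})"
      using S SV ab bS by (intro completable_Diff[OF S(2)] safe_if_partner_in[of a b]) auto
    then have "completable (S - {a} - {b})"
      by (rule completable_Diff)
        (use SV ab bS w False in \<open>auto intro: safe_if_partner_neighbour[of b a w]\<close>)
    moreover have "partner_closed (S - {a} - {b})"
      using S ab bS isolated_unique isolated_sym unfolding partner_closed_def by blast
    ultimately show ?thesis
      using ab by (intro exI[of _ "S - {a} - {b}"]) auto
  next
    case True
    then obtain v where v: "isolated w v" "isolated v w" "v \<in> S"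
      using S isolated_sym unfolding partner_closed_def matched_def by blast
    have ne: "v \<noteq> w" "v \<noteq> a" "v \<noteq> b"
      using v w wa ab bS isolated_neq isolated_unique by metis+
    \<comment> \<open>The edge from \<open>a\<close> to \<open>w\<close> secures both first
      vertices: when \<open>b\<close> is coloured, its partner \<open>a\<close> has the uncoloured
      neighbour \<open>w\<close>; when \<open>v\<close> is coloured, its partner \<open>w\<close>
      has the uncoloured neighbour \<open>a\<close>.\<close>
    have "completable (S - {w})"
      using S SV v True ne by (intro completable_Diff[OF S(2)] safe_if_partner_in[of w v]) auto
    then have "completable (S - {w} - {a})"
      by (rule completable_Diff)
        (use SV ab bS w wa in \<open>auto intro: safe_if_partner_in[of a b]\<close>)
    then have "completable (S - {w} - {a} - {v})"
      by (rule completable_Diff)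
        (use SV v ne wa in \<open>auto intro: safe_if_partner_neighbour[of v w a]\<close>)
    then have "completable (S - {w} - {a} - {v} - {b})"
      by (rule completable_Diff)
        (use SV bS ne w in \<open>auto intro: safe_if_partner_neighbour[of b a w]\<close>)
    moreover have "partner_closed (S - {w} - {a} - {v} - {b})"
      using S ab bS v isolated_unique isolated_sym unfolding partner_closed_def by blast
    ultimately show ?thesis
      using ab by (intro exI[of _ "S - {w} - {a} - {v} - {b}"]) auto
  qed
qed

lemma completable_partner_closed: "finite S \<Longrightarrow> partner_closed S \<Longrightarrow> completable S \<Longrightarrow> completable {}"
proof (induction S rule: finite_psubset_induct)
  case (psubset S)
  show ?case
  proof (cases "S = {}")
    case True
    with psubset.prems show ?thesis by simp
  next
    case False
    then obtain T where "T \<subset> S" "partner_closed T" "completable T"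
      using completable_shrink[OF psubset.prems] by blast
    then show ?thesis
      by (rule psubset.IH)
  qed
qed

lemma labelling_realizable:
  obtains f :: "'a \<Rightarrow> bit ^ 4"
  where "\<And>u v. v \<in> N u \<Longrightarrow> scalar_product (f u) (f v) = p u v"
proof -
  have "partner_closed matched"
    unfolding partner_closed_def matched_def using isolated_sym by blast
  then have "completable {}"
    using completable_partner_closed completable_matched finite_subset[OF matched_subset finite_V] by blast
  \<comment> \<open>With nothing coloured all the families are empty, so any \<open>f\<close> is a
    starting point.\<close>
  moreover have "good {} f" for f
    by (auto simp: good_def extendable_def independent_on_def solutions_def)
  ultimately obtain f where "good V f"
    unfolding completable_def by blast
  then have "scalar_product (f u) (f v) = p u v" if "v \<in> N u" for u v
    using that N_subset N_sym unfolding good_def by blast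
  then show ?thesis
    using that by blast
qed

end


section \<open>Distances in the inversion graph\<close>

text \<open>A pair is flipped once for each index at which both vectors have entry 1, so the parity
  is their product restricted to \<open>is\<close>. Distinctness lets the sum over the set count
  each inversion once.\<close>

lemma mem_parcs_fold_inversion:
  fixes f :: "'a \<Rightarrow> bit ^ 'n"
  assumes "distinct is"
  shows "(u, v) \<in> parcs (fold (\<lambda>i. inversion {w\<in>V. f w $ i = 1}) is D) \<longleftrightarrow>
    (if u \<in> V \<and> v \<in> V \<and> (\<Sum>i\<in>set is. f u $ i * f v $ i) = 1 then (v, u) else (u, v)) \<in> parcs D"
  using assms
proof (induction "is" arbitrary: D)
  case Nil
  then show ?case by simp
next
  case (Cons i "is")
  then show ?case
    by (cases "f u $ i"; cases "f v $ i"; cases "\<Sum>i\<in>set is. f u $ i * f v $ i")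
      (auto simp: mem_parcs_inversion)
qed

lemma pverts_fold_inversion [simp]: "pverts (fold (\<lambda>i. inversion (X i)) is D) = pverts D"
  by (induction "is" arbitrary: D) (auto simp: inversion_def)

lemma awalk_fold_inversion:
  assumes "pair_graph G" "D \<in> orientations G" "\<And>i. X i \<subseteq> pverts G"
  shows "\<exists>p. pre_digraph.awalk (with_proj (inversion_graph G)) D p (fold (\<lambda>i. inversion (X i)) is D) \<and>
    length p \<le> length is"
  using assms(2)
proof (induction "is" arbitrary: D)
  interpret H: pair_graph "inversion_graph G"
    by (rule pair_graph_inversion_graph) fact
  {
    case Nil
    then show ?case
      by (intro exI[of _ "[]"]) (simp add: H.awalk_Nil_iff, simp add: inversion_graph_def)
  next
    case (Cons i "is")
    let ?E = "inversion (X i) D"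
    have E: "?E \<in> orientations G"
      using inversion_in_orientations assms(1) Cons.prems by blast
    then obtain p where p: "H.awalk ?E p (fold (\<lambda>i. inversion (X i)) is ?E)" "length p \<le> length is"
      using Cons.IH by blast
    show ?case
    \<comment> \<open>An inversion that changes nothing is not an arc and is skipped, which is why
      the length is only bounded above.\<close>
    proof (cases "D = ?E")
      case True
      with p show ?thesis by auto
    next
      case False
      then have "(D, ?E) \<in> parcs (inversion_graph G)"
        using Cons.prems E assms(3) by (auto simp: inversion_graph_def)
      with p have "H.awalk D ((D, ?E) # p) (fold (\<lambda>i. inversion (X i)) is ?E)"
        by (auto simp: H.awalk_Cons_iff)
      with p show ?thesis
        by (intro exI[of _ "(D, ?E) # p"]) auto
    qed
  }
qed

text \<open>Stated for every \<open>v\<close>, as the locale demands; outside the vertex set there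
  are no neighbours.\<close>

lemma card_neighbours_le_max_degree:
  assumes "pair_graph G"
  shows "card {w. (v, w) \<in> parcs G} \<le> max_degree G"
proof -
  interpret pair_graph G by fact
  show ?thesis
  proof (cases "v \<in> pverts G")
    case True
    have "out_arcs (with_proj G) v = Pair v ` {w. (v, w) \<in> parcs G}"
      by (auto simp: out_arcs_def)
    then have "card {w. (v, w) \<in> parcs G} = out_degree (with_proj G) v"
      by (simp add: out_degree_def card_image inj_on_def)
    also have "\<dots> \<le> max_degree G"
      unfolding max_degree_def using True by (intro cSUP_upper) auto
    finally show ?thesis .
  next
    case False
    then have "{w. (v, w) \<in> parcs G} = {}"
      using in_arcsD1 by auto
    then show ?thesis by simp
  qed
qed

lemma distance_inversion_graph_le:
  assumes G: "pair_graph G" and deg: "max_degree G \<le> 3"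
    and D: "D \<in> orientations G" and D': "D' \<in> orientations G"
  shows "distance (with_proj (inversion_graph G)) D D' \<le> 4"
proof -
  interpret pair_graph G by fact
  interpret H: pair_graph "inversion_graph G"
    by (rule pair_graph_inversion_graph) fact
  define N where "N v = {w. (v, w) \<in> parcs G}" for v
  \<comment> \<open>Label 1 marks the edges that \<open>D\<close> and \<open>D'\<close> orient
    differently.\<close>
  define p :: "'a \<Rightarrow> 'a \<Rightarrow> bit" where
    "p u v = of_bool ((u, v) \<in> parcs G \<and> ((u, v) \<in> parcs D \<longleftrightarrow> (u, v) \<notin> parcs D'))" for u v
  interpret subcubic_edge_labelling "pverts G" N p
  proof
    show "p u v = p v u" for u v
    proof (cases "(u, v) \<in> parcs G")
      case True
      then have "(v, u) \<in> parcs G"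
        by (rule arcs_symmetric)
      with True show ?thesis
        using orientationsD(3)[OF D True] orientationsD(3)[OF D' True] by (simp add: p_def)
    next
      case False
      then have "(v, u) \<notin> parcs G"
        using arcs_symmetric by blast
      with False show ?thesis
        by (simp add: p_def)
    qed
    show "card (N v) \<le> 3" for v
      unfolding N_def using card_neighbours_le_max_degree[OF G] deg le_trans by blast
  qed (auto simp: N_def in_arcsD2 arcs_symmetric dest: no_loops')
  obtain f :: "'a \<Rightarrow> bit ^ 4" where f: "\<And>u v. v \<in> N u \<Longrightarrow> scalar_product (f u) (f v) = p u v"
    using labelling_realizable by blast
  obtain "is" :: "4 list" where "is": "set is = UNIV" "distinct is"
    using finite_distinct_list[OF finite[of UNIV]] by blast
  then have len: "length is = 4"
    using distinct_card[OF "is"(2)] by simp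
  define X where "X i = {w \<in> pverts G. f w $ i = 1}" for i
  let ?E = "fold (\<lambda>i. inversion (X i)) is D"
  have "(u, v) \<in> parcs ?E \<longleftrightarrow> (u, v) \<in> parcs D'" for u v
  proof (cases "(u, v) \<in> parcs G")
    case True
    then have "u \<in> pverts G" "v \<in> pverts G"
      using in_arcsD1 in_arcsD2 by auto
    then have "(u, v) \<in> parcs ?E \<longleftrightarrow> (if p u v = 1 then (v, u) else (u, v)) \<in> parcs D"
      unfolding X_def using f[of v u] True
      by (simp add: mem_parcs_fold_inversion "is" scalar_product_def N_def)
    also have "\<dots> \<longleftrightarrow> (u, v) \<in> parcs D'"
      using True orientationsD(3)[OF D True] by (auto simp: p_def)
    finally show ?thesis .
  next
    case False
    \<comment> \<open>Neither direction is an arc of \<open>D\<close>, so a flip has no effect,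
      whatever the product of the two vectors.\<close>
    then have "(u, v) \<notin> parcs D" "(v, u) \<notin> parcs D" "(u, v) \<notin> parcs D'"
      using orientationsD(2)[OF D] orientationsD(2)[OF D'] arcs_symmetric by blast+
    then show ?thesis
      unfolding X_def by (simp add: mem_parcs_fold_inversion "is")
  qed
  then have "?E = D'"
    using orientationsD(1)[OF D] orientationsD(1)[OF D']
    by (intro pair_pre_digraph.equality) auto
  then obtain q where q: "H.awalk D q D'" "length q \<le> 4"
    using awalk_fold_inversion[OF G D, of X "is"] len by (auto simp: X_def)
  have "distance (with_proj (inversion_graph G)) D D' \<le> H.awalk_cost (\<lambda>_. 1) q"
    unfolding distance_def using q(1) by (rule H.min_cost_le_walk_cost)
  also have "\<dots> \<le> 4"
    using q(2) by (simp add: H.awalk_cost_def sum_list_triv)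
  finally show ?thesis .
qed

theorem theorem6p7:
  fixes G :: "'a pair_pre_digraph"
  assumes "pair_graph G"
    and "max_degree G \<le> 3"
  shows "diameter (with_proj (inversion_graph G)) \<le> 4"
  unfolding diameter_def
  using assms by (intro SUP_least distance_inversion_graph_le) (auto simp: inversion_graph_def)

end
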